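(* Let $\lambda\in\{1,2,\ldots\}$, $p\in(0,1)$, $q=1-p$, $0\le m\le\lambda$, and for each integer $\kappa\ge0$ let $Z_\kappa\sim\mathcal{B}(\kappa,p)$. Then for all bounded $F:\mathbf{R}\to\mathbf{R}$, $$E\,K_\lambda^m(Z_\lambda)F(Z_\lambda)=(\lambda)_m(pq)^m\,E\,\Delta^mF(Z_{\lambda-m}),$$ and hence $(Z_\lambda)_\lambda^{(m)}=Z_{\lambda-m}$ in distribution; that is, the discrete transformation of order $m$ induced by the Krawtchouk polynomial $K_\lambda^m$ maps $\mathcal{B}(\lambda,p)$ to $\mathcal{B}(\lambda-m,p)$.
   Context: $\mathcal{B}(\kappa,p)$ is the Binomial distribution with $\kappa$ trials and success probability $p$. The (monic) Krawtchouk polynomials $K_\lambda^m$, $0\le m\le\lambda$, orthogonal with respect to $\mathcal{B}(\lambda,p)$, are defined by the generating function $$(1+qt)^x(1-pt)^{\lambda-x}=\sum_{m=0}^\lambda\frac{t^m}{m!}K_\lambda^m(x)$$ (for $x=0,1,\ldots,\lambda$), equivalently by the Rodriguez formula $$K_\lambda^m(x)=\frac{(-1)^mm!\binom\lambda mp^{m-x}q^x}{\binom\lambda x}\nabla^m\left\{\binom{\lambda-m}{x}\left(\frac pq\right)^x\right\}.$$ Here $(\lambda)_m=\lambda(\lambda-1)\cdots(\lambda-m+1)$, $\nabla f(x)=f(x)-f(x-1)$, $\Delta f(x)=f(x+1)-f(x)$, and $\nabla^m,\Delta^m$ are $m$-fold iterates. For an integer valued random variable $X$ and function $P$, the discrete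 $X$-$P$ biased distribution of order $m$ is the distribution of a variable $X^{(m)}$ such that, for a constant $\alpha>0$, $E\,P(X)F(X)=\alpha\,E\,\Delta^mF(X^{(m)})$ for all $F:\mathbf{R}\to\mathbf{R}$ with $E|P(X)F(X)|<\infty$; for $P=K_\lambda^m$ it is denoted $X_\lambda^{(m)}$. *)

theory Defs
  imports "HOL-Probability.Probability" "HOL-Computational_Algebra.Computational_Algebra"
begin

text \<open>
  The coefficient of \<open>t^m / m!\<close> in \<open>(1 + q t)^x (1 - p t)^(l - x)\<close>, where \<open>q = 1 - p\<close>. Read as an
  identity of formal power series in \<open>t\<close> (generalised binomial series) this makes sense for every
  real \<open>x\<close> and is a monic polynomial of degree \<open>m\<close> in \<open>x\<close>; see \<open>krawtchouk_generating_function\<close>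
  and \<open>krawtchouk_monic\<close> below.
\<close>

definition krawtchouk :: "real \<Rightarrow> nat \<Rightarrow> nat \<Rightarrow> real \<Rightarrow> real" where
  "krawtchouk p l m x =
     fact m * fps_nth ((fps_binomial x oo (fps_const (1 - p) * fps_X)) *
                       (fps_binomial (real l - x) oo (fps_const (- p) * fps_X))) m"

lemma fps_binomial_compose_linear_of_nat:
  "fps_binomial (real n) oo (fps_const (c :: real) * fps_X) = fps_of_poly ([:1, c:] ^ n)"
proof -
  have "fps_binomial (real n) oo (fps_const c * fps_X)
      = ((1 + fps_X) oo (fps_const c * fps_X)) ^ n"
    by (simp add: fps_binomial_of_nat fps_compose_power)
  also have "(1 + fps_X) oo (fps_const c * fps_X) = fps_of_poly [:1, c:]"
    by (simp add: fps_compose_add_distrib fps_of_poly_pCons mult.commute)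
  finally show ?thesis by (simp add: fps_of_poly_power)
qed

lemma krawtchouk_generating_function:
  assumes "x \<le> l"
  shows "(1 + (1 - p) * t) ^ x * (1 - p * t) ^ (l - x)
       = (\<Sum>m\<le>l. t ^ m / fact m * krawtchouk p l m (real x))"
proof -
  define P where "P = [:1, 1 - p:] ^ x * [:1, - p:] ^ (l - x)"
  have l: "real l - real x = real (l - x)"
    using assms by (simp add: of_nat_diff)
  have K: "krawtchouk p l m (real x) = fact m * coeff P m" for m
    unfolding krawtchouk_def l fps_binomial_compose_linear_of_nat P_def
      fps_of_poly_mult [symmetric] by simp
  have "degree P \<le> degree ([:1, 1 - p:] ^ x) + degree ([:1, - p:] ^ (l - x))"
    unfolding P_def by (rule degree_mult_le)
  also have "\<dots> \<le> 1 * x + 1 * (l - x)"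
    by (intro add_mono order.trans [OF degree_power_le] mult_mono) auto
  finally have "degree P \<le> l" using assms by simp
  then have "poly P t = (\<Sum>m\<le>l. coeff P m * t ^ m)"
    unfolding poly_altdef by (intro sum.mono_neutral_left) (auto simp: coeff_eq_0)
  moreover have "poly P t = (1 + (1 - p) * t) ^ x * (1 - p * t) ^ (l - x)"
    by (simp add: P_def algebra_simps)
  ultimately show ?thesis by (simp add: K mult.commute)
qed

lemma krawtchouk_monic:
  "\<exists>P. degree P = m \<and> lead_coeff P = 1 \<and> (\<forall>x. krawtchouk p l m x = poly P x)"
proof -
  define A where "A j = (\<Prod>i<j. [:- real i, 1:])" for j
  define B where "B j = (\<Prod>i<j. [:real l - real i, -1:])" for j
  define c where "c j = real (m choose j) * (1 - p) ^ j * (- p) ^ (m - j)" for j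
  define P where "P = (\<Sum>j\<le>m. smult (c j) (A j * B (m - j)))"
  have dA: "degree (A j) = j" for j
    by (simp add: A_def degree_prod_eq_sum_degree)
  have "lead_coeff (A j) = 1" for j
    unfolding A_def lead_coeff_prod by simp
  with dA have A: "degree (A j) = j" "coeff (A j) j = 1" for j
    by simp_all
  have dB: "degree (B j) = j" for j
    by (simp add: B_def degree_prod_eq_sum_degree)
  have "lead_coeff (B j) = (-1) ^ j" for j
    unfolding B_def lead_coeff_prod by simp
  with dB have B: "degree (B j) = j" "coeff (B j) j = (-1) ^ j" for j
    by simp_all
  have pA: "poly (A j) x = fact j * (x gchoose j)" for j x
    by (simp add: A_def poly_prod gbinomial_mult_fact atLeast0LessThan)
  have pB: "poly (B j) x = fact j * ((real l - x) gchoose j)" for j x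
    by (simp add: B_def poly_prod gbinomial_mult_fact atLeast0LessThan algebra_simps)
  have AB: "degree (A j * B k) \<le> j + k" for j k
    using degree_mult_le [of "A j" "B k"] A B by simp
  have lAB: "coeff (A j * B k) (j + k) = (-1) ^ k" for j k
    using coeff_mult_degree_sum [of "A j" "B k"] A B by simp
  have deg: "degree P \<le> m"
    unfolding P_def
    by (intro degree_sum_le) (use AB in \<open>auto intro: order.trans [OF degree_smult_le]
      simp: order.trans [OF AB]\<close>)
  have "coeff P m = (\<Sum>j\<le>m. c j * coeff (A j * B (m - j)) (j + (m - j)))"
    by (simp add: P_def coeff_sum)
  also have "\<dots> = (\<Sum>j\<le>m. real (m choose j) * (1 - p) ^ j * p ^ (m - j))"
    by (intro sum.cong refl, subst lAB)
       (simp add: c_def mult.assoc flip: power_mult_distrib)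
  also have "\<dots> = ((1 - p) + p) ^ m"
    by (subst binomial_ring) simp
  finally have lead: "coeff P m = 1" by simp
  have "degree P = m"
    using deg lead by (metis le_antisym le_degree zero_neq_one)
  moreover have "krawtchouk p l m x = poly P x" for x
  proof -
    have "krawtchouk p l m x =
        (\<Sum>j\<le>m. fact m * (((1 - p) ^ j * (x gchoose j)) *
            ((- p) ^ (m - j) * ((real l - x) gchoose (m - j)))))"
      unfolding krawtchouk_def fps_compose_linear
      by (simp add: fps_mult_nth atLeast0AtMost sum_distrib_left)
    also have "\<dots> = (\<Sum>j\<le>m. c j * (poly (A j) x * poly (B (m - j)) x))"
      by (intro sum.cong refl) (simp add: c_def pA pB binomial_fact field_simps)
    also have "\<dots> = poly P x"
      by (simp add: P_def poly_sum)
    finally show ?thesis .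
  qed
  ultimately show ?thesis using lead by blast
qed

definition falling_factorial :: "real \<Rightarrow> nat \<Rightarrow> real" where
  "falling_factorial x m = (\<Prod>i<m. x - real i)"

definition forward_diff :: "(real \<Rightarrow> real) \<Rightarrow> real \<Rightarrow> real" where
  "forward_diff F x = F (x + 1) - F x"

definition binomial_law :: "nat \<Rightarrow> real \<Rightarrow> real pmf" where
  "binomial_law k p = map_pmf real (binomial_pmf k p)"

text \<open>
  \<open>\<nu>\<close> is the discrete \<open>X\<close>-\<open>P\<close> biased distribution of order \<open>m\<close>, where \<open>\<mu>\<close> is the law of the integer
  valued variable \<open>X\<close>. Test functions \<open>F\<close> are arbitrary, not only measurable; this is why \<open>\<nu>\<close> is a
  discrete law. Since the Bochner integral of a non-integrable function is 0, existence
  of the expectation of the \<open>m\<close>-th difference is required explicitly.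
\<close>

definition discrete_biased_law ::
    "real pmf \<Rightarrow> (real \<Rightarrow> real) \<Rightarrow> nat \<Rightarrow> real pmf \<Rightarrow> bool" where
  "discrete_biased_law \<mu> P m \<nu> \<longleftrightarrow>
     set_pmf \<mu> \<subseteq> \<int> \<and>
     (\<exists>\<alpha>>0. \<forall>F :: real \<Rightarrow> real.
        integrable (measure_pmf \<mu>) (\<lambda>x. P x * F x) \<longrightarrow>
        integrable (measure_pmf \<nu>) ((forward_diff ^^ m) F) \<and>
        measure_pmf.expectation \<mu> (\<lambda>x. P x * F x) =
          \<alpha> * measure_pmf.expectation \<nu> ((forward_diff ^^ m) F))"

end

theory Submission
  imports Defs
begin

text \<open>
  The identity is umbral. Fix \<open>F\<close> and let \<open>L\<close> be the linear functional on real polynomials with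
  \<open>L (X ^ n) = F n\<close>. Multiplication by \<open>X\<close> then acts as the shift, so that
  \<open>L (X ^ n * (X - 1) ^ m)\<close> is the \<open>m\<close>-th forward difference of \<open>F\<close> at \<open>n\<close>
  (\<open>umbral_forward_diff\<close>), and expectations under a binomial law become values of \<open>L\<close> at powers
  of \<open>p X + q\<close> (\<open>umbral_binomial\<close>). Multiply the expectation of \<open>K\<^sub>m F\<close> by \<open>t ^ m / m!\<close> and sum
  over \<open>m\<close>: by the generating function the total is \<open>L\<close> applied to

     \<open>(p (1 + q t) X + q (1 - p t)) ^ l = ((p X + q) + p q t (X - 1)) ^ l\<close>.

  Expanding the right-hand side in powers of \<open>t\<close> and comparing coefficients gives the identity
  (\<open>expectation_krawtchouk\<close>). Binomial laws have finite support, so all the expectations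
  are finite sums.

  For uniqueness of the biased law, every \<open>g\<close> on the real line is an \<open>m\<close>-th difference
  (\<open>surj_forward_diff\<close>), because the difference equation can be solved separately on each coset
  of the integers. Hence two biased laws with constants \<open>\<alpha>\<close> and \<open>\<beta>\<close> have
  \<open>\<alpha> E g = \<beta> E' g\<close> for all such \<open>g\<close>; taking \<open>g = 1\<close> shows \<open>\<alpha> = \<beta>\<close>, and taking indicators
  of points shows that the laws agree (\<open>discrete_biased_law_unique\<close>).
\<close>

definition umbral :: "(real \<Rightarrow> real) \<Rightarrow> real poly \<Rightarrow> real" where
  "umbral F P = (\<Sum>i\<le>degree P. coeff P i * F (real i))"

lemma umbral_eq_sum:
  assumes "degree P \<le> n"
  shows "umbral F P = (\<Sum>i\<le>n. coeff P i * F (real i))"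
  unfolding umbral_def using assms
  by (intro sum.mono_neutral_left) (auto simp: coeff_eq_0)

lemma umbral_add: "umbral F (P + Q) = umbral F P + umbral F Q"
proof -
  define n where "n = max (degree P) (degree Q)"
  have "degree (P + Q) \<le> n" "degree P \<le> n" "degree Q \<le> n"
    by (auto simp: n_def intro: degree_add_le)
  then show ?thesis
    by (simp add: umbral_eq_sum sum.distrib algebra_simps)
qed

lemma umbral_smult: "umbral F (smult c P) = c * umbral F P"
  unfolding umbral_eq_sum [OF degree_smult_le] by (simp add: umbral_def sum_distrib_left mult.assoc)

lemma umbral_diff: "umbral F (P - Q) = umbral F P - umbral F Q"
proof -
  have "P - Q = P + smult (-1) Q" by simp
  then show ?thesis by (simp only: umbral_add umbral_smult)
qed

lemma umbral_sum: "umbral F (\<Sum>i\<in>A. P i) = (\<Sum>i\<in>A. umbral F (P i))"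
proof -
  have "umbral F 0 = 0" by (simp add: umbral_def)
  then show ?thesis
    by (induction A rule: infinite_finite_induct) (simp_all add: umbral_add)
qed

lemma umbral_forward_diff:
  "umbral F ([:0, 1:] ^ n * [:-1, 1:] ^ m) = (forward_diff ^^ m) F (real n)"
proof (induction m arbitrary: n)
  case 0
  have "umbral F (monom 1 n) = (\<Sum>i\<le>n. if i = n then F (real i) else 0)"
    unfolding umbral_def by (intro sum.cong) (auto simp: degree_monom_eq)
  moreover have "[:0, 1::real:] ^ n = monom 1 n" by (simp add: monom_altdef)
  ultimately show ?case by simp
next
  case (Suc m)
  have "x ^ n * y ^ Suc m = x ^ Suc n * y ^ m - x ^ n * y ^ m" if "y = x - 1"
    for x y :: "real poly"
    by (simp add: that algebra_simps)
  from this [of "[:-1, 1:]" "[:0, 1:]"]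
  have "[:0, 1:] ^ n * [:-1, 1:] ^ Suc m =
      [:0, 1:] ^ Suc n * [:-1, 1:] ^ m - [:0, 1::real:] ^ n * [:-1, 1:] ^ m"
    by (simp only: one_pCons) simp
  then show ?case
    by (simp only: umbral_diff Suc.IH) (simp add: forward_diff_def add.commute)
qed

lemma umbral_binomial:
  "umbral F ([:b, a:] ^ k * [:-1, 1:] ^ m) =
     (\<Sum>i\<le>k. real (k choose i) * a ^ i * b ^ (k - i) * (forward_diff ^^ m) F (real i))"
proof -
  have "[:b, a:] ^ k = (smult a [:0, 1:] + [:b:]) ^ k" by simp
  also have "\<dots> = (\<Sum>i\<le>k. of_nat (k choose i) * (smult a [:0, 1:]) ^ i * [:b:] ^ (k - i))"
    by (rule binomial_ring)
  also have "\<dots> = (\<Sum>i\<le>k. smult (real (k choose i) * a ^ i * b ^ (k - i)) ([:0, 1:] ^ i))"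
    by (intro sum.cong refl)
       (simp only: smult_power poly_const_pow of_nat_poly, simp add: mult_ac)
  finally show ?thesis
    by (simp only: sum_distrib_right umbral_sum mult_smult_left umbral_smult umbral_forward_diff)
qed

lemma finite_set_binomial_law:
  assumes "0 \<le> p" "p \<le> 1"
  shows "finite (set_pmf (binomial_law k p))"
  using assms by (simp add: binomial_law_def set_pmf_binomial_eq)

lemma expectation_binomial_law:
  assumes "0 \<le> p" "p \<le> 1"
  shows "measure_pmf.expectation (binomial_law k p) f =
         (\<Sum>i\<le>k. real (k choose i) * p ^ i * (1 - p) ^ (k - i) * f (real i))"
  using assms by (simp add: binomial_law_def expectation_binomial_pmf' mult_ac)

lemma falling_factorial_of_nat:
  "falling_factorial (real l) m = fact m * real (l choose m)"
  by (simp add: falling_factorial_def binomial_gbinomial gbinomial_mult_fact atLeast0LessThan)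

lemma expectation_krawtchouk:
  assumes p: "0 \<le> p" "p \<le> 1" and "m \<le> l"
  shows "measure_pmf.expectation (binomial_law l p) (\<lambda>x. krawtchouk p l m x * F x) =
         falling_factorial (real l) m * (p * (1 - p)) ^ m *
           measure_pmf.expectation (binomial_law (l - m) p) ((forward_diff ^^ m) F)"
proof -
  define q where "q = 1 - p"
  define a where "a k = measure_pmf.expectation (binomial_law l p)
    (\<lambda>x. krawtchouk p l k x * F x) / fact k" for k
  define b where "b k = real (l choose k) * (p * q) ^ k *
    measure_pmf.expectation (binomial_law (l - k) p) ((forward_diff ^^ k) F)" for k
  have "(\<Sum>k\<le>l. a k * t ^ k) = (\<Sum>k\<le>l. b k * t ^ k)" for t
  proof -
    have "(\<Sum>k\<le>l. a k * t ^ k) = (\<Sum>k\<le>l. \<Sum>i\<le>l. real (l choose i) * p ^ i * q ^ (l - i) *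
            (t ^ k / fact k * krawtchouk p l k (real i)) * F (real i))"
      unfolding a_def expectation_binomial_law [OF p] q_def sum_divide_distrib sum_distrib_right
      by (simp add: mult_ac)
    also have "\<dots> = (\<Sum>i\<le>l. \<Sum>k\<le>l. real (l choose i) * p ^ i * q ^ (l - i) *
            (t ^ k / fact k * krawtchouk p l k (real i)) * F (real i))"
      by (rule sum.swap)
    also have "\<dots> = (\<Sum>i\<le>l. real (l choose i) * p ^ i * q ^ (l - i) *
            ((1 + q * t) ^ i * (1 - p * t) ^ (l - i)) * F (real i))"
      unfolding q_def
      by (intro sum.cong refl)
         (simp only: atMost_iff krawtchouk_generating_function sum_distrib_left sum_distrib_right)
    also have "\<dots> = umbral F ([:q * (1 - p * t), p * (1 + q * t):] ^ l)"
      using umbral_binomial [of F "q * (1 - p * t)" "p * (1 + q * t)" l 0]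
      by (simp add: power_mult_distrib mult_ac)
    also have "[:q * (1 - p * t), p * (1 + q * t):] = smult (p * q * t) [:-1, 1:] + [:q, p:]"
      by (simp add: algebra_simps)
    also have "\<dots> ^ l = (\<Sum>k\<le>l. smult (real (l choose k) * (p * q * t) ^ k)
            ([:q, p:] ^ (l - k) * [:-1, 1:] ^ k))"
      unfolding binomial_ring
      by (intro sum.cong refl)
         (simp only: smult_power of_nat_poly, simp add: mult_ac)
    also have "umbral F \<dots> = (\<Sum>k\<le>l. b k * t ^ k)"
      unfolding umbral_sum umbral_smult umbral_binomial b_def expectation_binomial_law [OF p] q_def
      by (simp add: power_mult_distrib mult_ac)
    finally show ?thesis .
  qed
  then have "a m = b m"
    using \<open>m \<le> l\<close> polyfun_eq_coeffs [of a l b] by blast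
  then show ?thesis
    using \<open>m \<le> l\<close> by (simp add: a_def b_def q_def falling_factorial_of_nat field_simps)
qed

text \<open>
  On each coset \<open>r + \<int>\<close> with \<open>0 \<le> r < 1\<close> an antidifference is a sum of values of \<open>g\<close> starting
  from \<open>r\<close>, with the opposite sign to the left of \<open>r\<close>.
\<close>

lemma surj_forward_diff: "surj (forward_diff ^^ m)"
proof -
  have "surj forward_diff"
  proof (rule surjI)
    define S where "S g x = (\<Sum>k\<in>{0..<\<lfloor>x\<rfloor>}. g (frac x + of_int k)) -
        (\<Sum>k\<in>{\<lfloor>x\<rfloor>..<0}. g (frac x + of_int k))" for g :: "real \<Rightarrow> real" and x :: real
    show "forward_diff (S g) = g" for g
    proof
      fix x :: real
      have fl: "\<lfloor>x + 1\<rfloor> = \<lfloor>x\<rfloor> + 1" "frac (x + 1) = frac x"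
        by (simp_all add: frac_def)
      have x: "frac x + of_int \<lfloor>x\<rfloor> = x"
        by (simp add: frac_def)
      show "forward_diff (S g) x = g x"
      proof (cases "0 \<le> \<lfloor>x\<rfloor>")
        case True
        then have "{0..<\<lfloor>x\<rfloor> + 1} = insert \<lfloor>x\<rfloor> {0..<\<lfloor>x\<rfloor>}" by auto
        with True show ?thesis by (simp add: forward_diff_def S_def fl x)
      next
        case False
        then have "{\<lfloor>x\<rfloor>..<0} = insert \<lfloor>x\<rfloor> {\<lfloor>x\<rfloor> + 1..<0}" by auto
        moreover have "{0..<\<lfloor>x\<rfloor> + 1} = {}" using False by auto
        ultimately show ?thesis using False
          by (simp only: forward_diff_def S_def fl) (simp add: x)
      qed
    qed
  qed
  then show ?thesis by (rule surj_fn)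
qed

lemma discrete_biased_law_unique:
  assumes fin: "finite (set_pmf \<mu>)"
    and \<nu>: "discrete_biased_law \<mu> P m \<nu>" and \<nu>': "discrete_biased_law \<mu> P m \<nu>'"
  shows "\<nu> = \<nu>'"
proof -
  have int: "integrable (measure_pmf \<mu>) (\<lambda>x. P x * F x)" for F
    by (rule integrable_measure_pmf_finite [OF fin])
  obtain \<alpha> where \<alpha>: "\<alpha> > 0" "\<And>F. measure_pmf.expectation \<mu> (\<lambda>x. P x * F x) =
      \<alpha> * measure_pmf.expectation \<nu> ((forward_diff ^^ m) F)"
    using \<nu> int unfolding discrete_biased_law_def by blast
  obtain \<beta> where \<beta>: "\<And>F. measure_pmf.expectation \<mu> (\<lambda>x. P x * F x) =
      \<beta> * measure_pmf.expectation \<nu>' ((forward_diff ^^ m) F)"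
    using \<nu>' int unfolding discrete_biased_law_def by blast
  have eq: "\<alpha> * measure_pmf.expectation \<nu> g = \<beta> * measure_pmf.expectation \<nu>' g" for g
  proof -
    obtain F where F: "g = (forward_diff ^^ m) F"
      using surj_forward_diff [of m] by (rule surjE)
    show ?thesis
      unfolding F using \<alpha>(2) [of F] \<beta> [of F] by (rule trans [OF sym])
  qed
  have "\<alpha> = \<beta>" using eq [of "\<lambda>_. 1"] by simp
  then have "measure_pmf.prob \<nu> {x} = measure_pmf.prob \<nu>' {x}" for x
    using eq [of "indicator {x}"] \<alpha>(1) by simp
  then show ?thesis
    by (intro pmf_eqI) (simp add: measure_pmf_single)
qed

theorem mainTheorem9:
  fixes l m :: nat and p q :: real
  assumes "l \<ge> 1" and "0 < p" and "p < 1" and "q = 1 - p" and "m \<le> l"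
  shows "(\<forall>F :: real \<Rightarrow> real. bounded (range F) \<longrightarrow>
            measure_pmf.expectation (binomial_law l p) (\<lambda>x. krawtchouk p l m x * F x) =
            falling_factorial (real l) m * (p * q) ^ m *
              measure_pmf.expectation (binomial_law (l - m) p) ((forward_diff ^^ m) F)) \<and>
         (\<forall>\<nu>. discrete_biased_law (binomial_law l p) (krawtchouk p l m) m \<nu> \<longleftrightarrow>
              \<nu> = binomial_law (l - m) p)"
proof -
  have p: "0 \<le> p" "p \<le> 1" using assms by auto
  have E: "measure_pmf.expectation (binomial_law l p) (\<lambda>x. krawtchouk p l m x * F x) =
      falling_factorial (real l) m * (p * q) ^ m *
        measure_pmf.expectation (binomial_law (l - m) p) ((forward_diff ^^ m) F)" for F
    unfolding \<open>q = 1 - p\<close> by (rule expectation_krawtchouk [OF p \<open>m \<le> l\<close>])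
  have "falling_factorial (real l) m * (p * q) ^ m > 0"
    using assms by (simp add: falling_factorial_of_nat)
  moreover have "set_pmf (binomial_law l p) \<subseteq> \<int>"
    by (auto simp: binomial_law_def)
  moreover have "integrable (measure_pmf (binomial_law (l - m) p)) g" for g :: "real \<Rightarrow> real"
    by (rule integrable_measure_pmf_finite [OF finite_set_binomial_law [OF p]])
  ultimately have biased:
    "discrete_biased_law (binomial_law l p) (krawtchouk p l m) m (binomial_law (l - m) p)"
    unfolding discrete_biased_law_def using E by blast
  show ?thesis
    using E biased discrete_biased_law_unique [OF finite_set_binomial_law [OF p] _ biased] by blast
qed

end
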